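(* Let $X$ be a real Banach space. Then $$\operatorname{dent}(B_X) = \{x \in S_X : \delta c(x) = 0 \}.$$
   Context: $B_X$, $S_X$, $X^*$ denote the closed unit ball, unit sphere and topological dual of $X$. A slice of $B_X$ is a set $S(x^*,\delta)=\{y\in B_X : x^*(y)>1-\delta\}$ with $x^*\in S_{X^*}$ and $\delta>0$. A point $x\in S_X$ is a denting point of $B_X$ if there are slices of $B_X$ containing $x$ of arbitrarily small diameter; $\operatorname{dent}(B_X)$ is the set of all denting points of $B_X$. For $x\in B_X$, the $\Delta$-constant $\delta c(x)$ is the supremum of all $\alpha\ge 0$ such that for all $\varepsilon,\delta>0$ and all $y^*\in S_{X^*}$ with $x\in S(y^*,\delta)$ there exists $y\in S(y^*,\delta)$ with $\|y-x\|>\alpha-\varepsilon$. *)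

theory Defs
  imports "HOL-Analysis.Analysis"
begin

text \<open>The dual of \<^typ>\<open>'a\<close> is the type \<^typ>\<open>'a \<Rightarrow>\<^sub>L real\<close> of bounded linear functionals with
  the operator norm; slices are taken with functionals in its unit sphere.\<close>

definition slice :: "('a::real_normed_vector \<Rightarrow>\<^sub>L real) \<Rightarrow> real \<Rightarrow> 'a set"
  where "slice f \<delta> = {y \<in> cball 0 1. blinfun_apply f y > 1 - \<delta>}"

definition dent_ball :: "'a::real_normed_vector set"
  where "dent_ball = {x \<in> sphere 0 1. \<forall>\<epsilon>>0. \<exists>f \<in> sphere 0 1. \<exists>\<delta>>0.
           x \<in> slice f \<delta> \<and> diameter (slice f \<delta>) < \<epsilon>}"

text \<open>The set below always contains \<^term>\<open>0::real\<close> when \<^term>\<open>norm x \<le> 1\<close>, and it is bounded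
  above by 2 as soon as the space is nonzero (then the dual unit sphere is nonempty, and a slice
  with \<open>\<delta> > 2\<close> is the whole ball), so the real supremum is the genuine one. On the
  zero space the set is unbounded and the value is meaningless, but there the unit sphere is empty.\<close>

definition delta_const :: "'a::real_normed_vector \<Rightarrow> real"
  where "delta_const x = Sup {\<alpha>. 0 \<le> \<alpha> \<and>
           (\<forall>\<epsilon>>0. \<forall>\<delta>>0. \<forall>f \<in> sphere 0 1. x \<in> slice f \<delta> \<longrightarrow>
              (\<exists>y \<in> slice f \<delta>. norm (y - x) > \<alpha> - \<epsilon>))}"

end

theory Submission
  imports Defs
begin

text \<open>
  For \<open>\<alpha> > 0\<close>, failure of the \<open>\<Delta>\<close>-condition at \<open>\<alpha>\<close> says precisely that some slice containing
  \<open>x\<close> lies in a ball around \<open>x\<close> of radius less than \<open>\<alpha>\<close>, and the diameter of a slice containing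
  \<open>x\<close> is comparable to its radius around \<open>x\<close>. The supremum is over a bounded set only because the
  dual unit sphere is nonempty, a case of the Hahn-Banach theorem. The latter is obtained from a
  minimal sublinear functional, which is necessarily linear.
\<close>

section \<open>Sublinear functionals and their linear minorants\<close>

definition sublinear :: "('a::real_vector \<Rightarrow> real) \<Rightarrow> bool"
  where "sublinear q \<longleftrightarrow> (\<forall>x y. q (x + y) \<le> q x + q y) \<and> (\<forall>c>0. \<forall>x. q (c *\<^sub>R x) \<le> c * q x)"

lemma sublinear_add: "sublinear q \<Longrightarrow> q (x + y) \<le> q x + q y"
  by (simp add: sublinear_def)

lemma sublinear_scaleR_le: "sublinear q \<Longrightarrow> c > 0 \<Longrightarrow> q (c *\<^sub>R x) \<le> c * q x"
  by (simp add: sublinear_def)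

lemma sublinear_0:
  assumes "sublinear q"
  shows "q 0 = 0"
  \<comment> \<open>The factor 2 forces \<open>q 0 \<ge> 0\<close>, the factor 1/2 forces
    \<open>q 0 \<le> 0\<close>.\<close>
  using sublinear_scaleR_le[OF assms, of 2 0] sublinear_scaleR_le[OF assms, of "1/2" 0] by simp

text \<open>Scaling back by \<open>inverse c\<close> reverses the inequality. Hence the definition
  asks for one inequality only, which is what infima preserve directly.\<close>

lemma sublinear_scaleR:
  assumes "sublinear q" "c \<ge> 0"
  shows "q (c *\<^sub>R x) = c * q x"
proof (cases "c = 0")
  case True
  then show ?thesis by (simp add: sublinear_0[OF assms(1)])
next
  case False
  then have c: "c > 0" using assms(2) by simp
  have "q x \<le> inverse c * q (c *\<^sub>R x)"
    using sublinear_scaleR_le[OF assms(1), of "inverse c" "c *\<^sub>R x"] c by simp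
  then have "c * q x \<le> q (c *\<^sub>R x)"
    using c by (simp add: field_simps)
  with sublinear_scaleR_le[OF assms(1) c, of x] show ?thesis by simp
qed

lemma sublinear_ge_minus:
  assumes "sublinear q"
  shows "- q (- x) \<le> q x"
  using sublinear_add[OF assms, of x "- x"] sublinear_0[OF assms] by simp

text \<open>The largest sublinear functional below \<open>q\<close> whose value at \<open>- a\<close> is at most \<open>- q a\<close>.\<close>

definition flatten :: "('a::real_vector \<Rightarrow> real) \<Rightarrow> 'a \<Rightarrow> 'a \<Rightarrow> real"
  where "flatten q a y = (INF t\<in>{0..}. q (y + t *\<^sub>R a) - t * q a)"

text \<open>A real infimum bounds its terms from below only if they are bounded below: here \<open>t
  * q a = q (t *\<^sub>R a) \<le> q (y + t *\<^sub>R a) + q (- y)\<close> gives the bound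
  \<open>- q (- y)\<close>.\<close>

lemma flatten_le:
  assumes "sublinear q" "t \<ge> 0"
  shows "flatten q a y \<le> q (y + t *\<^sub>R a) - t * q a"
  unfolding flatten_def
proof (rule cINF_lower)
  show "bdd_below ((\<lambda>t. q (y + t *\<^sub>R a) - t * q a) ` {0..})"
  proof (rule bdd_belowI2[where m = "- q (- y)"])
    fix t :: real
    assume "t \<in> {0..}"
    then show "- q (- y) \<le> q (y + t *\<^sub>R a) - t * q a"
      using sublinear_add[OF assms(1), of "y + t *\<^sub>R a" "- y"]
        sublinear_scaleR[OF assms(1), of t a] by simp
  qed
qed (use assms in simp)

lemma flatten_greatest:
  assumes "\<And>t. t \<ge> 0 \<Longrightarrow> m \<le> q (y + t *\<^sub>R a) - t * q a"
  shows "m \<le> flatten q a y"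
  unfolding flatten_def using assms by (intro cINF_greatest) auto

text \<open>Parameters \<open>t\<close> for \<open>x\<close> and \<open>s\<close> for
  \<open>y\<close> combine to \<open>t + s\<close> for \<open>x + y\<close>, and scaling by
  \<open>c\<close> turns \<open>t\<close> into \<open>c * t\<close>.\<close>

lemma sublinear_flatten:
  assumes q: "sublinear q"
  shows "sublinear (flatten q a)"
  unfolding sublinear_def
proof (intro conjI allI impI)
  fix x y
  \<comment> \<open>The two infima are taken one after the other: first over \<open>t\<close> with
    \<open>s\<close> fixed, then over \<open>s\<close>.\<close>
  have "flatten q a (x + y) - (q (y + s *\<^sub>R a) - s * q a) \<le> flatten q a x" if s: "s \<ge> 0" for s
  proof (rule flatten_greatest)
    fix t :: real
    assume "t \<ge> 0"
    then show "flatten q a (x + y) - (q (y + s *\<^sub>R a) - s * q a) \<le> q (x + t *\<^sub>R a) - t * q a"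
      using flatten_le[OF q, of "t + s" a "x + y"] s
        sublinear_add[OF q, of "x + t *\<^sub>R a" "y + s *\<^sub>R a"]
      by (simp add: algebra_simps)
  qed
  then have "flatten q a (x + y) - flatten q a x \<le> flatten q a y"
    by (intro flatten_greatest) (simp add: algebra_simps)
  then show "flatten q a (x + y) \<le> flatten q a x + flatten q a y" by simp
next
  fix c :: real and x
  assume c: "c > 0"
  have "flatten q a (c *\<^sub>R x) / c \<le> flatten q a x"
  proof (rule flatten_greatest)
    fix t :: real
    assume t: "t \<ge> 0"
    have "flatten q a (c *\<^sub>R x) \<le> q (c *\<^sub>R (x + t *\<^sub>R a)) - c * t * q a"
      using flatten_le[OF q, of "c * t" a "c *\<^sub>R x"] c t by (simp add: algebra_simps)
    also have "\<dots> = c * (q (x + t *\<^sub>R a) - t * q a)"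
      using sublinear_scaleR[OF q, of c "x + t *\<^sub>R a"] c by (simp add: right_diff_distrib)
    finally show "flatten q a (c *\<^sub>R x) / c \<le> q (x + t *\<^sub>R a) - t * q a"
      using c by (simp add: pos_divide_le_eq mult.commute)
  qed
  then show "flatten q a (c *\<^sub>R x) \<le> c * flatten q a x"
    using c by (simp add: pos_divide_le_eq mult.commute)
qed

text \<open>The parameter 0 shows \<open>flatten q y \<le> q\<close>, so minimality makes them
  equal. The parameter 1 then gives \<open>q x \<le> q (x + y) - q y\<close>, the converse of
  subadditivity.\<close>

lemma minimal_sublinear_imp_linear:
  assumes q: "sublinear q" and min: "\<And>r. sublinear r \<Longrightarrow> r \<le> q \<Longrightarrow> r = q"
  shows "linear q"
proof (rule linearI)
  have add: "q (x + y) = q x + q y" for x y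
  proof -
    have "flatten q y \<le> q"
      using flatten_le[OF q, of 0 y] by (simp add: le_fun_def)
    then have "flatten q y = q"
      using min sublinear_flatten[OF q] by blast
    then show ?thesis
      using flatten_le[OF q, of 1 y x] sublinear_add[OF q, of x y] by simp
  qed
  then show "q (x + y) = q x + q y" for x y .
  have minus: "q (- x) = - q x" for x
    using add[of x "- x"] sublinear_0[OF q] by simp
  show "q (c *\<^sub>R x) = c *\<^sub>R q x" for c x
    using sublinear_scaleR[OF q, of c x] sublinear_scaleR[OF q, of "- c" x] minus[of "c *\<^sub>R x"]
    by (cases "c \<ge> 0") auto
qed

text \<open>For \<open>q\<close> and \<open>r\<close> in the chain, the smaller one \<open>s\<close>
  satisfies \<open>s x + s y \<le> q x + r y\<close>. This lets the infima over \<open>q\<close> and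
  \<open>r\<close> be taken independently.\<close>

lemma sublinear_INF_chain:
  assumes "C \<noteq> {}" and sub: "\<And>q. q \<in> C \<Longrightarrow> sublinear q"
    and chain: "\<And>q r. q \<in> C \<Longrightarrow> r \<in> C \<Longrightarrow> q \<le> r \<or> r \<le> q"
    and bdd: "\<And>x. bdd_below ((\<lambda>q. q x) ` C)"
  shows "sublinear (\<lambda>x. INF q\<in>C. q x)"
  unfolding sublinear_def
proof (intro conjI allI impI)
  let ?g = "\<lambda>x. INF q\<in>C. q x"
  have lower: "?g x \<le> q x" if "q \<in> C" for q x
    using that by (intro cINF_lower bdd)
  fix x y
  have *: "?g (x + y) \<le> q x + r y" if qr: "q \<in> C" "r \<in> C" for q r
  proof -
    obtain s where s: "s \<in> C" "s \<le> q" "s \<le> r"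
      using chain[OF qr] qr by blast
    have "?g (x + y) \<le> s x + s y"
      using lower[OF s(1), of "x + y"] sublinear_add[OF sub[OF s(1)], of x y] by linarith
    also have "\<dots> \<le> q x + r y"
      using s by (intro add_mono) (auto simp: le_fun_def)
    finally show ?thesis .
  qed
  have "?g (x + y) - r y \<le> ?g x" if "r \<in> C" for r
    using \<open>C \<noteq> {}\<close> *[OF _ that] by (intro cINF_greatest) (auto simp: algebra_simps)
  then have "?g (x + y) - ?g x \<le> ?g y"
    using \<open>C \<noteq> {}\<close> by (intro cINF_greatest) (auto simp: algebra_simps)
  then show "?g (x + y) \<le> ?g x + ?g y" by simp
next
  let ?g = "\<lambda>x. INF q\<in>C. q x"
  fix c :: real and x
  assume c: "c > 0"
  have "?g (c *\<^sub>R x) / c \<le> ?g x"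
  proof (rule cINF_greatest)
    fix q
    assume q: "q \<in> C"
    have "?g (c *\<^sub>R x) \<le> q (c *\<^sub>R x)"
      using q by (intro cINF_lower bdd)
    also have "\<dots> \<le> c * q x"
      using sublinear_scaleR_le[OF sub[OF q] c] .
    finally show "?g (c *\<^sub>R x) / c \<le> q x"
      using c by (simp add: pos_divide_le_eq mult.commute)
  qed fact
  then show "?g (c *\<^sub>R x) \<le> c * ?g x"
    using c by (simp add: pos_divide_le_eq mult.commute)
qed

lemma sublinear_dominates_linear:
  assumes p: "sublinear p"
  obtains f where "linear f" "f \<le> p"
proof -
  let ?A = "{q. sublinear q \<and> q \<le> p}"
  have "\<exists>m\<in>?A. \<forall>q\<in>?A. q \<le> m \<longrightarrow> q = m"
  \<comment> \<open>The order is reversed, so maximal elements are minimal functionals and a chain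
    needs a lower bound.\<close>
  proof (rule predicate_Zorn[where P = "(\<ge>)"])
    show "partial_order_on ?A (relation_of (\<ge>) ?A)"
      by (rule partial_order_on_relation_ofI) auto
  next
    fix C
    assume "C \<in> Chains (relation_of (\<ge>) ?A)"
    then have C: "\<And>q. q \<in> C \<Longrightarrow> sublinear q \<and> q \<le> p"
      "\<And>q r. q \<in> C \<Longrightarrow> r \<in> C \<Longrightarrow> q \<le> r \<or> r \<le> q"
      unfolding Chains_def relation_of_def by blast+
    show "\<exists>u\<in>?A. \<forall>q\<in>C. q \<ge> u"
    \<comment> \<open>The infimum over an empty chain carries no information; there \<open>p\<close>
      itself serves as the bound.\<close>
    proof (cases "C = {}")
      case True
      with p show ?thesis by auto
    next
      case False
      have bdd: "bdd_below ((\<lambda>q. q x) ` C)" for x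
      \<comment> \<open>This bound is common to all of \<open>C\<close>, since
        \<open>- p (- x) \<le> - q (- x) \<le> q x\<close>.\<close>
      proof (rule bdd_belowI2[where m = "- p (- x)"])
        fix q
        assume "q \<in> C"
        with C(1) have "sublinear q" "q (- x) \<le> p (- x)"
          by (auto simp: le_fun_def)
        with sublinear_ge_minus[of q x] show "- p (- x) \<le> q x" by linarith
      qed
      let ?g = "\<lambda>x. INF q\<in>C. q x"
      have lower: "?g \<le> q" if "q \<in> C" for q
        unfolding le_fun_def using that by (intro allI cINF_lower bdd)
      have "sublinear ?g"
        using False C bdd by (intro sublinear_INF_chain) auto
      moreover have "?g \<le> p"
        using False lower C(1) by (meson all_not_in_conv order_trans)
      ultimately show ?thesis using lower by blast
    qed
  qed
  then obtain m where m: "sublinear m" "m \<le> p"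
    and min: "\<And>q. sublinear q \<Longrightarrow> q \<le> p \<Longrightarrow> q \<le> m \<Longrightarrow> q = m"
    by blast
  \<comment> \<open>Minimality among functionals below \<open>p\<close> is minimality among all
    sublinear ones, since anything below \<open>m\<close> is below \<open>p\<close>.\<close>
  have "linear m"
    using m min by (intro minimal_sublinear_imp_linear) (auto intro: order_trans)
  with m(2) that show thesis by blast
qed

section \<open>Functionals of norm one\<close>

lemma sublinear_norm: "sublinear norm"
  by (simp add: sublinear_def norm_triangle_ineq)

text \<open>A linear functional below \<open>norm\<close> could be zero. Staying below
  \<open>flatten norm x\<close> forces \<open>f (- x) \<le> - norm x < 0\<close>, so
  \<open>f\<close> is nonzero and can be normalised.\<close>

lemma dual_sphere_nonempty:
  fixes x :: "'a::real_normed_vector"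
  assumes "x \<noteq> 0"
  obtains f :: "'a \<Rightarrow>\<^sub>L real" where "norm f = 1"
proof -
  obtain f where f: "linear f" "f \<le> flatten norm x"
    using sublinear_dominates_linear[OF sublinear_flatten[OF sublinear_norm]] by blast
  have le: "f y \<le> norm y" for y
    using le_funD[OF f(2), of y] flatten_le[OF sublinear_norm, of 0 x y] by simp
  have "\<bar>f y\<bar> \<le> norm y" for y
    using le[of y] le[of "- y"] linear_neg[OF f(1), of y] by simp
  then have "bounded_linear f"
    using f(1) by (intro bounded_linear_intro[where K = 1])
      (auto simp: linear_add linear_scale)
  moreover have "f (- x) \<le> - norm x"
    using le_funD[OF f(2), of "- x"] flatten_le[OF sublinear_norm, of 1 x "- x"] by simp
  ultimately have "blinfun_apply (Blinfun f) (- x) \<noteq> 0"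
    using assms by (auto simp: bounded_linear_Blinfun_apply)
  then have "Blinfun f \<noteq> 0" by auto
  then have "norm (Blinfun f /\<^sub>R norm (Blinfun f)) = 1" by simp
  with that show thesis .
qed

section \<open>Slices and the condition defining the \<open>\<Delta>\<close>-constant\<close>

lemma mem_slice_large: "norm f = 1 \<Longrightarrow> norm x \<le> 1 \<Longrightarrow> x \<in> slice f 3"
  \<comment> \<open>Since \<open>f x \<ge> -1\<close>, the width 3 leaves room for the strict
    inequality \<open>f x > 1 - 3\<close>.\<close>
  using norm_blinfun[of f x] by (auto simp: slice_def)

lemma bounded_slice: "bounded (slice f \<delta>)"
  by (rule bounded_subset[OF bounded_cball[of 0 1]]) (auto simp: slice_def)

definition delta_set :: "'a::real_normed_vector \<Rightarrow> real set"
  where "delta_set x = {\<alpha>. 0 \<le> \<alpha> \<and>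
           (\<forall>\<epsilon>>0. \<forall>\<delta>>0. \<forall>f \<in> sphere 0 1. x \<in> slice f \<delta> \<longrightarrow>
              (\<exists>y \<in> slice f \<delta>. norm (y - x) > \<alpha> - \<epsilon>))}"

text \<open>For positive \<alpha> only the clause on slices can fail. The margin \<epsilon> of the
  failure corresponds to the radius \<open>\<beta> = \<alpha> - \<epsilon>\<close>, hence the strict
  \<open>\<beta> < \<alpha>\<close>.\<close>

lemma not_mem_delta_set_iff:
  assumes "\<alpha> > 0"
  shows "\<alpha> \<notin> delta_set x \<longleftrightarrow> (\<exists>\<beta><\<alpha>. \<exists>f \<in> sphere 0 1. \<exists>\<delta>>0. x \<in> slice f \<delta> \<and> slice f \<delta> \<subseteq> cball x \<beta>)"
    (is "_ \<longleftrightarrow> ?R")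
proof
  assume "\<alpha> \<notin> delta_set x"
  then obtain \<epsilon> f \<delta> where *: "\<epsilon> > 0" "\<delta> > 0" "f \<in> sphere 0 1" "x \<in> slice f \<delta>"
    and "\<And>y. y \<in> slice f \<delta> \<Longrightarrow> norm (y - x) \<le> \<alpha> - \<epsilon>"
    using assms unfolding delta_set_def by (auto simp: not_less)
  then have "slice f \<delta> \<subseteq> cball x (\<alpha> - \<epsilon>)"
    by (auto simp: dist_norm norm_minus_commute)
  moreover have "\<alpha> - \<epsilon> < \<alpha>" using * by simp
  ultimately show ?R using * by blast
next
  assume ?R
  then obtain \<beta> f \<delta> where *: "\<beta> < \<alpha>" "f \<in> sphere 0 1" "\<delta> > 0" "x \<in> slice f \<delta>"
    "slice f \<delta> \<subseteq> cball x \<beta>" by blast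
  have "\<not> norm (y - x) > \<alpha> - (\<alpha> - \<beta>)" if "y \<in> slice f \<delta>" for y
    using subsetD[OF *(5) that] by (simp add: dist_norm norm_minus_commute)
  moreover have "\<alpha> - \<beta> > 0" using * by simp
  ultimately show "\<alpha> \<notin> delta_set x"
    using *(2-4) unfolding delta_set_def by blast
qed

text \<open>The point \<open>x\<close> itself serves as \<open>y\<close>, as
  \<open>0 > - \<epsilon>\<close>.\<close>

lemma zero_mem_delta_set: "0 \<in> delta_set x"
  unfolding delta_set_def by force

lemma delta_set_nonneg: "\<alpha> \<in> delta_set x \<Longrightarrow> \<alpha> \<ge> 0"
  by (simp add: delta_set_def)

lemma delta_const_eq_Sup: "delta_const x = Sup (delta_set x)"
  by (simp add: delta_const_def delta_set_def)

text \<open>Given a functional of norm one, the whole unit ball is a slice, and it lies within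
  distance 2 of \<open>x\<close>.\<close>

lemma bdd_above_delta_set:
  fixes x :: "'a::real_normed_vector"
  assumes "norm x = 1"
  shows "bdd_above (delta_set x)"
proof (rule bdd_aboveI[where M = 2])
  fix \<alpha>
  assume \<alpha>: "\<alpha> \<in> delta_set x"
  show "\<alpha> \<le> 2"
  proof (rule ccontr)
    assume "\<not> \<alpha> \<le> 2"
    then have "\<alpha> > 2" by simp
    obtain f :: "'a \<Rightarrow>\<^sub>L real" where f: "norm f = 1"
      using dual_sphere_nonempty[of x] assms by fastforce
    have "slice f 3 \<subseteq> cball x 2"
    proof
      fix y
      assume "y \<in> slice f 3"
      then have "norm y \<le> 1" by (simp add: slice_def)
      with norm_triangle_ineq4[of x y] assms show "y \<in> cball x 2"
        by (simp add: dist_norm)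
    qed
    then have "\<exists>\<beta><\<alpha>. \<exists>f \<in> sphere 0 1. \<exists>\<delta>>0. x \<in> slice f \<delta> \<and> slice f \<delta> \<subseteq> cball x \<beta>"
      using \<open>\<alpha> > 2\<close> f mem_slice_large[OF f, of x] assms
      by (intro exI[of _ 2] conjI bexI[of _ f] exI[of _ 3]) auto
    with \<alpha> \<open>\<alpha> > 2\<close> show False
      using not_mem_delta_set_iff[of \<alpha> x] by simp
  qed
qed

text \<open>Boundedness puts every member below the supremum. Conversely, without positive members
  the set is \<open>{0}\<close>.\<close>

lemma delta_const_eq_0_iff:
  assumes "norm x = 1"
  shows "delta_const x = 0 \<longleftrightarrow> (\<forall>\<alpha>>0. \<alpha> \<notin> delta_set x)"
proof
  assume "delta_const x = 0"
  then have "\<alpha> \<le> 0" if "\<alpha> \<in> delta_set x" for \<alpha>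
    using cSup_upper[OF that bdd_above_delta_set[OF assms]] by (simp add: delta_const_eq_Sup)
  then show "\<forall>\<alpha>>0. \<alpha> \<notin> delta_set x" by (meson not_le)
next
  assume *: "\<forall>\<alpha>>0. \<alpha> \<notin> delta_set x"
  have "\<alpha> = 0" if "\<alpha> \<in> delta_set x" for \<alpha>
    using *[rule_format, of \<alpha>] that delta_set_nonneg[OF that] by (cases "\<alpha> > 0") auto
  then have "delta_set x = {0}"
    using zero_mem_delta_set[of x] by blast
  then show "delta_const x = 0" by (simp add: delta_const_eq_Sup)
qed

section \<open>Denting points through small slices\<close>

lemma dent_ball_iff:
  "x \<in> dent_ball \<longleftrightarrow> norm x = 1 \<and> (\<forall>\<alpha>>0. \<alpha> \<notin> delta_set x)"
proof -
  have "(\<forall>\<epsilon>>0. \<exists>f \<in> sphere 0 1. \<exists>\<delta>>0. x \<in> slice f \<delta> \<and> diameter (slice f \<delta>) < \<epsilon>)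
    \<longleftrightarrow> (\<forall>\<alpha>>0. \<alpha> \<notin> delta_set x)" (is "?L \<longleftrightarrow> ?R")
  proof (intro iffI allI impI)
    fix \<alpha> :: real
    assume ?L "\<alpha> > 0"
    then obtain f \<delta> where *: "f \<in> sphere 0 1" "\<delta> > 0" "x \<in> slice f \<delta>" "diameter (slice f \<delta>) < \<alpha>"
      by blast
    \<comment> \<open>As \<open>x\<close> lies in the slice, the diameter is a radius around
      \<open>x\<close>; being less than \<alpha>, it serves as \<beta>.\<close>
    have "slice f \<delta> \<subseteq> cball x (diameter (slice f \<delta>))"
      using diameter_bounded_bound[OF bounded_slice *(3)] by auto
    with * \<open>\<alpha> > 0\<close> show "\<alpha> \<notin> delta_set x"
      unfolding not_mem_delta_set_iff[OF \<open>\<alpha> > 0\<close>] by blast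
  next
    fix \<epsilon> :: real
    assume ?R "\<epsilon> > 0"
    \<comment> \<open>Passing from a radius to a diameter costs a factor 2, so a radius below
      \<open>\<epsilon> / 2\<close> is requested.\<close>
    then have "\<epsilon> / 2 > 0" "\<epsilon> / 2 \<notin> delta_set x" by auto
    then obtain \<beta> f \<delta> where *: "\<beta> < \<epsilon> / 2" "f \<in> sphere 0 1" "\<delta> > 0" "x \<in> slice f \<delta>"
      "slice f \<delta> \<subseteq> cball x \<beta>"
      using not_mem_delta_set_iff by blast
    \<comment> \<open>The ball of radius \<beta> contains \<open>x\<close>, so it is
      nonempty.\<close>
    then have "0 \<le> \<beta>" by auto
    have "diameter (slice f \<delta>) \<le> diameter (cball x \<beta>)"
      using *(5) by (rule diameter_subset) simp
    also have "\<dots> \<le> 2 * \<beta>"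
    proof (rule diameter_le)
      fix y z
      assume "y \<in> cball x \<beta>" "z \<in> cball x \<beta>"
      then show "norm (y - z) \<le> 2 * \<beta>"
        using dist_triangle2[of y z x] by (simp add: dist_norm norm_minus_commute)
    qed (use \<open>0 \<le> \<beta>\<close> in simp)
    finally show "\<exists>f \<in> sphere 0 1. \<exists>\<delta>>0. x \<in> slice f \<delta> \<and> diameter (slice f \<delta>) < \<epsilon>"
      using * by force
  qed
  then show ?thesis by (simp add: dent_ball_def)
qed

theorem proposition2p7:
  "(dent_ball :: 'a::banach set) = {x \<in> sphere 0 1. delta_const x = 0}"
  by (auto simp: dent_ball_iff delta_const_eq_0_iff)

end
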